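(* Let $(M^{2n},g,J)$ be a quasi-Kähler manifold. Then $M$ satisfies the second Gray condition $$(G_2):\quad R(X,Y,Z,U)-R(JX,JY,Z,U)=R(JX,Y,JZ,U)+R(JX,Y,Z,JU)\quad\text{for all }X,Y,Z,U\in TM$$ if and only if $$(\overline{\nabla}_X\eta)(Y,Z)=(\overline{\nabla}_Y\eta)(X,Z)\quad\text{for all }X,Y,Z\in TM.$$ In particular, in this case $$(\overline{\nabla}_{JX}\eta)(JY,Z)+(\overline{\nabla}_X\eta)(Y,Z)=0\quad\text{for all }X,Y,Z\in TM.$$
   Context: An almost Hermitian manifold $(M^{2n},g,J)$ is a Riemannian manifold with a $g$-compatible almost complex structure; $\nabla$ is the Levi-Civita connection. It is quasi-Kähler if $\nabla_{JX}J=-J\nabla_XJ$ for all $X$. Curvature: $R(X,Y)=\nabla_{[X,Y]}-[\nabla_X,\nabla_Y]$, $R(X,Y,Z,U)=g(R(X,Y)Z,U)$. Set $\eta(X,Y)=\eta_XY=\tfrac12(\nabla_XJ)JY$ and $\overline{\nabla}_XY=\nabla_XY+\eta_XY$ (the first canonical Hermitian connection). *)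

theory Defs
  imports "HOL-Analysis.Analysis" "HOL-Library.Function_Algebras"
begin

section \<open>Smooth manifolds\<close>

text \<open>Both notions below are used only for open sets \<open>S\<close>.\<close>

primrec Ck_on :: "nat \<Rightarrow> ('e::real_normed_vector \<Rightarrow> 'f::real_normed_vector) \<Rightarrow> 'e set \<Rightarrow> bool" where
  "Ck_on 0 = (\<lambda>f S. continuous_on S f)"
| "Ck_on (Suc k) = (\<lambda>f S. f differentiable_on S \<and>
     (\<forall>v. Ck_on k (\<lambda>x. frechet_derivative f (at x) v) S))"

definition smooth_on :: "('e::real_normed_vector \<Rightarrow> 'f::real_normed_vector) \<Rightarrow> 'e set \<Rightarrow> bool" where
  "smooth_on f S \<longleftrightarrow> (\<forall>k. Ck_on k f S)"

text \<open>The points of the manifold form a whole type \<open>'a\<close>; the Hausdorff and second countability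
  axioms are carried by the type classes. A chart is a pair of its domain and a coordinate map into
  the model space \<open>'e\<close>. An atlas is not required to be maximal: it determines its maximal
  atlas, and all later notions depend on the atlas only through the smooth functions.\<close>

type_synonym ('a, 'e) chart = "'a set \<times> ('a \<Rightarrow> 'e)"

definition smooth_atlas ::
  "('a::{t2_space, second_countable_topology}, 'e::euclidean_space) chart set \<Rightarrow> bool" where
  "smooth_atlas A \<longleftrightarrow>
     (\<Union>(U, \<phi>)\<in>A. U) = UNIV \<and>
     (\<forall>(U, \<phi>)\<in>A. open U \<and> open (\<phi> ` U) \<and> homeomorphism U (\<phi> ` U) \<phi> (inv_into U \<phi>)) \<and>
     (\<forall>(U, \<phi>)\<in>A. \<forall>(V, \<psi>)\<in>A. smooth_on (\<psi> \<circ> inv_into U \<phi>) (\<phi> ` (U \<inter> V)))"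

definition smooth_functions ::
  "('a::{t2_space, second_countable_topology}, 'e::euclidean_space) chart set \<Rightarrow> ('a \<Rightarrow> real) set" where
  "smooth_functions A = {f. \<forall>(U, \<phi>)\<in>A. smooth_on (f \<circ> inv_into U \<phi>) (\<phi> ` U)}"


section \<open>Tangent vectors and vector fields\<close>

text \<open>Tangent vectors at \<open>p\<close> are point derivations of the algebra of smooth functions. They are
  set to 0 on non-smooth functions, so that equality of tangent vectors is equality in HOL.
  Sums, differences and negatives of functions are pointwise throughout.\<close>

type_synonym 'a tvec = "('a \<Rightarrow> real) \<Rightarrow> real"
type_synonym 'a vfield = "'a \<Rightarrow> 'a tvec"

definition tangent_space ::
  "('a::{t2_space, second_countable_topology}, 'e::euclidean_space) chart set \<Rightarrow> 'a \<Rightarrow> 'a tvec set" where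
  "tangent_space A p = {v.
     (\<forall>f\<in>smooth_functions A. \<forall>h\<in>smooth_functions A.
        v (f + h) = v f + v h \<and> v (f * h) = v f * h p + f p * v h) \<and>
     (\<forall>c. \<forall>f\<in>smooth_functions A. v (\<lambda>q. c * f q) = c * v f) \<and>
     (\<forall>f. f \<notin> smooth_functions A \<longrightarrow> v f = 0)}"

definition vector_fields ::
  "('a::{t2_space, second_countable_topology}, 'e::euclidean_space) chart set \<Rightarrow> 'a vfield set" where
  "vector_fields A = {X. (\<forall>p. X p \<in> tangent_space A p) \<and>
     (\<forall>f\<in>smooth_functions A. (\<lambda>p. X p f) \<in> smooth_functions A)}"

definition tscale :: "real \<Rightarrow> 'a tvec \<Rightarrow> 'a tvec" where
  "tscale c v = (\<lambda>f. c * v f)"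

definition fscale :: "('a \<Rightarrow> real) \<Rightarrow> 'a vfield \<Rightarrow> 'a vfield" where
  "fscale h X = (\<lambda>p. tscale (h p) (X p))"

definition lie_bracket :: "'a vfield \<Rightarrow> 'a vfield \<Rightarrow> 'a vfield" where
  "lie_bracket X Y = (\<lambda>p f. X p (\<lambda>q. Y q f) - Y p (\<lambda>q. X q f))"


section \<open>Almost Hermitian structures\<close>

text \<open>Tensor fields are families of (multi)linear maps on the tangent spaces, smooth in the sense
  that they send smooth vector fields to smooth functions or smooth vector fields.\<close>

definition metric_app :: "('a \<Rightarrow> 'a tvec \<Rightarrow> 'a tvec \<Rightarrow> real) \<Rightarrow> 'a vfield \<Rightarrow> 'a vfield \<Rightarrow> 'a \<Rightarrow> real" where
  "metric_app g X Y = (\<lambda>p. g p (X p) (Y p))"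

definition endo_app :: "('a \<Rightarrow> 'a tvec \<Rightarrow> 'a tvec) \<Rightarrow> 'a vfield \<Rightarrow> 'a vfield" where
  "endo_app J X = (\<lambda>p. J p (X p))"

definition riemannian_metric ::
  "('a::{t2_space, second_countable_topology}, 'e::euclidean_space) chart set \<Rightarrow>
   ('a \<Rightarrow> 'a tvec \<Rightarrow> 'a tvec \<Rightarrow> real) \<Rightarrow> bool" where
  "riemannian_metric A g \<longleftrightarrow>
     (\<forall>p. \<forall>u\<in>tangent_space A p. \<forall>v\<in>tangent_space A p.
        g p u v = g p v u \<and>
        (\<forall>w\<in>tangent_space A p. g p (u + v) w = g p u w + g p v w) \<and>
        (\<forall>c. g p (tscale c u) v = c * g p u v)) \<and>
     (\<forall>p. \<forall>u\<in>tangent_space A p. u \<noteq> 0 \<longrightarrow> g p u u > 0) \<and>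
     (\<forall>X\<in>vector_fields A. \<forall>Y\<in>vector_fields A. metric_app g X Y \<in> smooth_functions A)"

definition almost_complex_structure ::
  "('a::{t2_space, second_countable_topology}, 'e::euclidean_space) chart set \<Rightarrow>
   ('a \<Rightarrow> 'a tvec \<Rightarrow> 'a tvec) \<Rightarrow> bool" where
  "almost_complex_structure A J \<longleftrightarrow>
     (\<forall>p. \<forall>u\<in>tangent_space A p.
        J p u \<in> tangent_space A p \<and> J p (J p u) = - u \<and>
        (\<forall>v\<in>tangent_space A p. J p (u + v) = J p u + J p v) \<and>
        (\<forall>c. J p (tscale c u) = tscale c (J p u))) \<and>
     (\<forall>X\<in>vector_fields A. endo_app J X \<in> vector_fields A)"

definition almost_hermitian ::
  "('a::{t2_space, second_countable_topology}, 'e::euclidean_space) chart set \<Rightarrow>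
   ('a \<Rightarrow> 'a tvec \<Rightarrow> 'a tvec \<Rightarrow> real) \<Rightarrow> ('a \<Rightarrow> 'a tvec \<Rightarrow> 'a tvec) \<Rightarrow> bool" where
  "almost_hermitian A g J \<longleftrightarrow>
     smooth_atlas A \<and> riemannian_metric A g \<and> almost_complex_structure A J \<and>
     (\<forall>p. \<forall>u\<in>tangent_space A p. \<forall>v\<in>tangent_space A p. g p (J p u) (J p v) = g p u v)"


section \<open>Connections and curvature\<close>

type_synonym 'a connection = "'a vfield \<Rightarrow> 'a vfield \<Rightarrow> 'a vfield"

definition affine_connection ::
  "('a::{t2_space, second_countable_topology}, 'e::euclidean_space) chart set \<Rightarrow> 'a connection \<Rightarrow> bool" where
  "affine_connection A D \<longleftrightarrow>
     (\<forall>X\<in>vector_fields A. \<forall>Y\<in>vector_fields A.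
        D X Y \<in> vector_fields A \<and>
        (\<forall>Z\<in>vector_fields A. D (X + Y) Z = D X Z + D Y Z \<and> D X (Y + Z) = D X Y + D X Z) \<and>
        (\<forall>h\<in>smooth_functions A. D (fscale h X) Y = fscale h (D X Y) \<and>
           D X (fscale h Y) = fscale (\<lambda>p. X p h) Y + fscale h (D X Y)))"

text \<open>The Levi-Civita connection is given by its characterising properties, which determine it
  uniquely on smooth vector fields.\<close>

definition levi_civita_connection ::
  "('a::{t2_space, second_countable_topology}, 'e::euclidean_space) chart set \<Rightarrow>
   ('a \<Rightarrow> 'a tvec \<Rightarrow> 'a tvec \<Rightarrow> real) \<Rightarrow> 'a connection \<Rightarrow> bool" where
  "levi_civita_connection A g D \<longleftrightarrow>
     affine_connection A D \<and>
     (\<forall>X\<in>vector_fields A. \<forall>Y\<in>vector_fields A. D X Y - D Y X = lie_bracket X Y) \<and>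
     (\<forall>X\<in>vector_fields A. \<forall>Y\<in>vector_fields A. \<forall>Z\<in>vector_fields A.
        (\<lambda>p. X p (metric_app g Y Z)) = metric_app g (D X Y) Z + metric_app g Y (D X Z))"

definition curvature :: "'a connection \<Rightarrow> 'a vfield \<Rightarrow> 'a vfield \<Rightarrow> 'a vfield \<Rightarrow> 'a vfield" where
  "curvature D X Y Z = D (lie_bracket X Y) Z - (D X (D Y Z) - D Y (D X Z))"

definition curvature4 :: "('a \<Rightarrow> 'a tvec \<Rightarrow> 'a tvec \<Rightarrow> real) \<Rightarrow> 'a connection \<Rightarrow>
    'a vfield \<Rightarrow> 'a vfield \<Rightarrow> 'a vfield \<Rightarrow> 'a vfield \<Rightarrow> 'a \<Rightarrow> real" where
  "curvature4 g D X Y Z U = metric_app g (curvature D X Y Z) U"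

text \<open>\<open>(\<nabla>\<^sub>X J) Y\<close>\<close>

definition cov_deriv_endo :: "'a connection \<Rightarrow> ('a \<Rightarrow> 'a tvec \<Rightarrow> 'a tvec) \<Rightarrow>
    'a vfield \<Rightarrow> 'a vfield \<Rightarrow> 'a vfield" where
  "cov_deriv_endo D J X Y = D X (endo_app J Y) - endo_app J (D X Y)"

definition quasi_kaehler ::
  "('a::{t2_space, second_countable_topology}, 'e::euclidean_space) chart set \<Rightarrow>
   ('a \<Rightarrow> 'a tvec \<Rightarrow> 'a tvec) \<Rightarrow> 'a connection \<Rightarrow> bool" where
  "quasi_kaehler A J D \<longleftrightarrow>
     (\<forall>X\<in>vector_fields A. \<forall>Y\<in>vector_fields A.
        cov_deriv_endo D J (endo_app J X) Y = - endo_app J (cov_deriv_endo D J X Y))"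

definition eta :: "'a connection \<Rightarrow> ('a \<Rightarrow> 'a tvec \<Rightarrow> 'a tvec) \<Rightarrow> 'a vfield \<Rightarrow> 'a vfield \<Rightarrow> 'a vfield" where
  "eta D J X Y = fscale (\<lambda>_. 1/2) (cov_deriv_endo D J X (endo_app J Y))"

definition canonical_hermitian_connection ::
  "'a connection \<Rightarrow> ('a \<Rightarrow> 'a tvec \<Rightarrow> 'a tvec) \<Rightarrow> 'a connection" where
  "canonical_hermitian_connection D J X Y = D X Y + eta D J X Y"

text \<open>\<open>(D\<^sub>X T) (Y, Z)\<close> for a vector-valued bilinear tensor field \<open>T\<close>\<close>

definition cov_deriv_bilinear :: "'a connection \<Rightarrow> ('a vfield \<Rightarrow> 'a vfield \<Rightarrow> 'a vfield) \<Rightarrow>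
    'a vfield \<Rightarrow> 'a vfield \<Rightarrow> 'a vfield \<Rightarrow> 'a vfield" where
  "cov_deriv_bilinear D T X Y Z = D X (T Y Z) - T (D X Y) Z - T Y (D X Z)"

text \<open>Tensor identities are stated for smooth vector fields at every point; since every tangent
  vector extends to a smooth vector field, these are identities on all tangent vectors.\<close>

definition second_gray_condition ::
  "('a::{t2_space, second_countable_topology}, 'e::euclidean_space) chart set \<Rightarrow>
   ('a \<Rightarrow> 'a tvec \<Rightarrow> 'a tvec \<Rightarrow> real) \<Rightarrow> ('a \<Rightarrow> 'a tvec \<Rightarrow> 'a tvec) \<Rightarrow> 'a connection \<Rightarrow> bool" where
  "second_gray_condition A g J D \<longleftrightarrow>
     (\<forall>X\<in>vector_fields A. \<forall>Y\<in>vector_fields A. \<forall>Z\<in>vector_fields A. \<forall>U\<in>vector_fields A.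
        curvature4 g D X Y Z U - curvature4 g D (endo_app J X) (endo_app J Y) Z U =
        curvature4 g D (endo_app J X) Y (endo_app J Z) U +
        curvature4 g D (endo_app J X) Y Z (endo_app J U))"

end

theory Submission
  imports Defs
begin

text \<open>
  Let \<open>D\<close> be the Levi-Civita connection, \<open>D'\<close> the canonical Hermitian connection,
  \<open>E(X,Y) = (D'\<^sub>X \<eta>)\<^sub>Y\<close> as an endomorphism, and \<open>T(X,Y) = \<eta>\<^sub>X Y - \<eta>\<^sub>Y X\<close> the torsion of \<open>D'\<close>.
  Substituting \<open>D = D' - \<eta>\<close> into the curvature operator \<open>K(X,Y)\<close> of \<open>D\<close> gives
  \<open>K(X,Y) = K'(X,Y) + N(X,Y) - [\<eta>\<^sub>X, \<eta>\<^sub>Y]\<close>, where \<open>K'\<close> is the curvature of \<open>D'\<close> and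
  \<open>N(X,Y) = E(X,Y) - E(Y,X) + \<eta>\<^sub>T\<^sub>(\<^sub>X\<^sub>,\<^sub>Y\<^sub>)\<close>. Since \<open>D'\<close> preserves \<open>J\<close> while every \<open>\<eta>\<^sub>X\<close> anticommutes
  with it, \<open>K'\<close> and the commutator commute with \<open>J\<close> and \<open>N\<close> anticommutes with it. So \<open>N(X,Y)\<close> is
  exactly the \<open>J\<close>-anticommuting part of \<open>K(X,Y)\<close> (\<open>K_anticommuting_part\<close>).

  By the pair symmetry of the curvature tensor both sides of the second Gray condition only see
  this part, and the condition reads \<open>g(N(Z,U)X, Y) = g(N(JX,Y)Z, JU)\<close>
  (\<open>second_gray_iff_N\<close>). As soon as \<open>N(JX,JY) = -N(X,Y)\<close>, the tensor \<open>g(N(X,Y)Z, U)\<close> is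
  the part of the curvature tensor that is \<open>J\<close>-anti-invariant in each of the two pairs,
  hence is itself pair symmetric (\<open>N_pair_sym\<close>). The Gray condition forces this anti-invariance,
  and it then collapses to \<open>N(JX,Y) = J N(X,Y)\<close> (\<open>second_gray_iff_N_J\<close>).

  The quasi-Kaehler condition says \<open>\<eta>\<^sub>J\<^sub>X = -J \<eta>\<^sub>X\<close>, which makes the torsion term of \<open>N\<close> satisfy
  this last identity automatically. What remains is a condition on \<open>E(X,Y) - E(Y,X)\<close>. Combined with
  \<open>E(X,JY) = -J E(X,Y)\<close> it is a linear system in \<open>E(X,Y)\<close> and \<open>E(Y,X)\<close> whose only solutions have
  \<open>E(X,Y) = E(Y,X)\<close> (\<open>E_symmetric_iff\<close>). If \<open>E\<close> is symmetric, \<open>J\<close> can be moved out of either argument,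
  so \<open>E(JX,JY) = J J E(X,Y) = -E(X,Y)\<close>.

  Beyond the symmetries of the curvature tensor, the argument is pure algebra: it uses nothing but
  additivity of the operations on the space of smooth vector fields, so no frames and no extensions
  of tangent vectors enter. Charts matter only in showing that this space is closed under linear
  combinations.
\<close>

section \<open>Linear operations on smooth functions and vector fields\<close>

lemma Ck_on_cong:
  assumes "open S" "\<And>x. x \<in> S \<Longrightarrow> f x = h x" "Ck_on k f S"
  shows "Ck_on k h S"
  using assms(2,3)
proof (induction k arbitrary: f h)
  case 0
  have "continuous_on S f = continuous_on S h"
    by (rule continuous_on_cong) (use 0(1) in \<open>simp_all (no_asm_simp)\<close>)
  then show ?case using 0(2) by simp
next
  case (Suc k)
  have deriv: "(h has_derivative frechet_derivative f (at x)) (at x)" if "x \<in> S" for x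
  proof -
    have "f differentiable_on S" using Suc.prems(2) by simp
    then have "f differentiable (at x)"
      unfolding differentiable_on_def using that at_within_open[OF that assms(1)] by fastforce
    then have "(f has_derivative frechet_derivative f (at x)) (at x)"
      by (simp add: frechet_derivative_works)
    then show ?thesis
      by (rule has_derivative_transform_within_open[OF _ assms(1) that Suc.prems(1)])
  qed
  have "h differentiable_on S"
    unfolding differentiable_on_def
    by (rule ballI, rule differentiable_at_withinI, rule differentiableI, rule deriv)
  moreover have "Ck_on k (\<lambda>x. frechet_derivative h (at x) v) S" for v
  proof (rule Suc.IH)
    show "frechet_derivative f (at x) v = frechet_derivative h (at x) v" if "x \<in> S" for x
      by (rule fun_cong[OF frechet_derivative_at[OF deriv[OF that]]])
    show "Ck_on k (\<lambda>x. frechet_derivative f (at x) v) S" using Suc.prems(2) by simp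
  qed
  ultimately show ?case by simp
qed

text \<open>This is where the charts enter: openness of \<open>S\<close> turns differentiability within \<open>S\<close> into the
  full derivative in terms of which higher smoothness is defined. It makes the smooth functions,
  and with them the smooth vector fields, real vector spaces.\<close>

lemma Ck_on_linear_combination:
  assumes "open S" "Ck_on k f S" "Ck_on k h S"
  shows "Ck_on k (\<lambda>x. a *\<^sub>R f x + b *\<^sub>R h x) S"
  using assms(2,3)
proof (induction k arbitrary: f h)
  case 0
  then show ?case by (auto intro!: continuous_intros)
next
  case (Suc k)
  have deriv: "((\<lambda>x. a *\<^sub>R f x + b *\<^sub>R h x) has_derivative
      (\<lambda>v. a *\<^sub>R frechet_derivative f (at x) v + b *\<^sub>R frechet_derivative h (at x) v)) (at x)"
    if "x \<in> S" for x
  proof -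
    have "f differentiable_on S" "h differentiable_on S" using Suc.prems by simp_all
    then have "f differentiable (at x)" "h differentiable (at x)"
      unfolding differentiable_on_def using that at_within_open[OF that assms(1)] by fastforce+
    then show ?thesis
      unfolding frechet_derivative_works
      by (intro has_derivative_add has_derivative_scaleR_right)
  qed
  have "(\<lambda>x. a *\<^sub>R f x + b *\<^sub>R h x) differentiable_on S"
    unfolding differentiable_on_def
    by (rule ballI, rule differentiable_at_withinI, rule differentiableI, rule deriv)
  moreover have "Ck_on k (\<lambda>x. frechet_derivative (\<lambda>x. a *\<^sub>R f x + b *\<^sub>R h x) (at x) v) S" for v
  proof (rule Ck_on_cong[OF assms(1)])
    show "Ck_on k (\<lambda>x. a *\<^sub>R frechet_derivative f (at x) v + b *\<^sub>R frechet_derivative h (at x) v) S"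
      by (rule Suc.IH) (use Suc.prems in simp_all)
    show "a *\<^sub>R frechet_derivative f (at x) v + b *\<^sub>R frechet_derivative h (at x) v
       = frechet_derivative (\<lambda>x. a *\<^sub>R f x + b *\<^sub>R h x) (at x) v" if "x \<in> S" for x
      by (rule fun_cong[OF frechet_derivative_at[OF deriv[OF that]]])
  qed
  ultimately show ?case by simp
qed

lemma smooth_functions_linear_combination:
  assumes "smooth_atlas A" "f \<in> smooth_functions A" "h \<in> smooth_functions A"
  shows "(\<lambda>q. a * f q + b * h q) \<in> smooth_functions A"
proof -
  have "Ck_on k ((\<lambda>q. a * f q + b * h q) \<circ> inv_into U \<phi>) (\<phi> ` U)" if "(U, \<phi>) \<in> A" for U \<phi> k
  proof -
    have "open (\<phi> ` U)" using assms(1) that by (auto simp: smooth_atlas_def)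
    moreover have "Ck_on k (f \<circ> inv_into U \<phi>) (\<phi> ` U)" "Ck_on k (h \<circ> inv_into U \<phi>) (\<phi> ` U)"
      using assms(2,3) that by (auto simp: smooth_functions_def smooth_on_def)
    ultimately show ?thesis
      using Ck_on_linear_combination[of "\<phi> ` U" k "f \<circ> inv_into U \<phi>" "h \<circ> inv_into U \<phi>" a b]
      by (simp add: o_def)
  qed
  then show ?thesis by (auto simp: smooth_functions_def smooth_on_def)
qed

lemma smooth_functions_scale:
  assumes "smooth_atlas A" "f \<in> smooth_functions A"
  shows "(\<lambda>q. c * f q) \<in> smooth_functions A"
  using smooth_functions_linear_combination[OF assms(1) assms(2) assms(2), of c 0] by simp

lemma smooth_functions_diff:
  assumes "smooth_atlas A" "f \<in> smooth_functions A" "h \<in> smooth_functions A"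
  shows "f - h \<in> smooth_functions A"
  using smooth_functions_linear_combination[OF assms, of 1 "-1"] by (simp add: fun_diff_def)

lemma tangent_space_add:
  assumes "u \<in> tangent_space A p" "v \<in> tangent_space A p"
  shows "u + v \<in> tangent_space A p"
proof -
  have u: "u (f + h) = u f + u h" "u (f * h) = u f * h p + f p * u h" "u (\<lambda>q. c * f q) = c * u f"
    and v: "v (f + h) = v f + v h" "v (f * h) = v f * h p + f p * v h" "v (\<lambda>q. c * f q) = c * v f"
    if "f \<in> smooth_functions A" "h \<in> smooth_functions A" for f h c
    using assms that unfolding tangent_space_def by blast+
  have "u f = 0" "v f = 0" if "f \<notin> smooth_functions A" for f
    using assms that unfolding tangent_space_def by blast+
  then show ?thesis
    unfolding tangent_space_def by (simp add: u v distrib_left distrib_right)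
qed

lemma tangent_space_tscale:
  assumes "v \<in> tangent_space A p"
  shows "tscale c v \<in> tangent_space A p"
proof -
  have v: "v (f + h) = v f + v h" "v (f * h) = v f * h p + f p * v h" "v (\<lambda>q. b * f q) = b * v f"
    if "f \<in> smooth_functions A" "h \<in> smooth_functions A" for f h b
    using assms that unfolding tangent_space_def by blast+
  have "v f = 0" if "f \<notin> smooth_functions A" for f
    using assms that unfolding tangent_space_def by blast
  then show ?thesis
    unfolding tangent_space_def tscale_def by (simp add: v distrib_left)
qed

lemma vector_fields_add:
  assumes "smooth_atlas A" "X \<in> vector_fields A" "Y \<in> vector_fields A"
  shows "X + Y \<in> vector_fields A"
proof -
  have "(\<lambda>p. (X + Y) p f) \<in> smooth_functions A" if "f \<in> smooth_functions A" for f
    using smooth_functions_linear_combination[OF assms(1), of "\<lambda>p. X p f" "\<lambda>p. Y p f" 1 1] assms(2,3) that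
    by (simp add: vector_fields_def)
  moreover have "(X + Y) p \<in> tangent_space A p" for p
    using tangent_space_add[of "X p" A p "Y p"] assms(2,3) by (simp add: vector_fields_def)
  ultimately show ?thesis unfolding vector_fields_def by blast
qed

lemma vector_fields_scale:
  assumes "smooth_atlas A" "X \<in> vector_fields A"
  shows "fscale (\<lambda>_. c) X \<in> vector_fields A"
proof -
  have "(\<lambda>p. fscale (\<lambda>_. c) X p f) \<in> smooth_functions A" if "f \<in> smooth_functions A" for f
    using smooth_functions_scale[OF assms(1), of "\<lambda>p. X p f" c] assms(2) that
    by (simp add: vector_fields_def fscale_def tscale_def)
  moreover have "fscale (\<lambda>_. c) X p \<in> tangent_space A p" for p
    using tangent_space_tscale[of "X p" A p c] assms(2) by (simp add: vector_fields_def fscale_def)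
  ultimately show ?thesis unfolding vector_fields_def by blast
qed

lemma vector_fields_uminus:
  assumes "smooth_atlas A" "X \<in> vector_fields A"
  shows "- X \<in> vector_fields A"
proof -
  have "- X = fscale (\<lambda>_. -1) X" by (simp add: fscale_def tscale_def fun_eq_iff)
  then show ?thesis using vector_fields_scale[OF assms, of "-1"] by simp
qed

lemma vector_fields_diff:
  assumes "smooth_atlas A" "X \<in> vector_fields A" "Y \<in> vector_fields A"
  shows "X - Y \<in> vector_fields A"
  using vector_fields_add[OF assms(1,2) vector_fields_uminus[OF assms(1,3)]] by simp

lemma vector_field_apply_add:
  assumes "X \<in> vector_fields A" "f \<in> smooth_functions A" "h \<in> smooth_functions A"
  shows "X p (f + h) = X p f + X p h"
  using assms unfolding vector_fields_def tangent_space_def by blast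

lemma vector_field_apply_diff:
  assumes "smooth_atlas A" "X \<in> vector_fields A" "f \<in> smooth_functions A" "h \<in> smooth_functions A"
  shows "X p (f - h) = X p f - X p h"
  using vector_field_apply_add[OF assms(2) smooth_functions_diff[OF assms(1,3,4)] assms(4), of p]
  by simp

lemma vector_field_apply_smooth:
  assumes "X \<in> vector_fields A" "f \<in> smooth_functions A"
  shows "(\<lambda>p. X p f) \<in> smooth_functions A"
  using assms unfolding vector_fields_def by blast

lemma vector_field_nonsmooth:
  assumes "X \<in> vector_fields A" "f \<notin> smooth_functions A"
  shows "X p f = 0"
  using assms unfolding vector_fields_def tangent_space_def by blast

text \<open>Vector fields are additive on smooth functions only, so the usual cancellation covers just these;
  on all other functions every term vanishes.\<close>

lemma lie_bracket_jacobi: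
  assumes A: "smooth_atlas A" and X: "X \<in> vector_fields A" and Y: "Y \<in> vector_fields A"
    and Z: "Z \<in> vector_fields A"
  shows "lie_bracket (lie_bracket X Y) Z + lie_bracket (lie_bracket Y Z) X
    + lie_bracket (lie_bracket Z X) Y = 0"
proof (intro ext)
  fix p f
  have double: "lie_bracket (lie_bracket X' Y') Z' p f =
      X' p (\<lambda>q. Y' q (\<lambda>r. Z' r f)) - Y' p (\<lambda>q. X' q (\<lambda>r. Z' r f))
      - (Z' p (\<lambda>q. X' q (\<lambda>r. Y' r f)) - Z' p (\<lambda>q. Y' q (\<lambda>r. X' r f)))"
    if "f \<in> smooth_functions A" "X' \<in> vector_fields A" "Y' \<in> vector_fields A" "Z' \<in> vector_fields A"
    for X' Y' Z'
  proof -
    have "Z' p ((\<lambda>q. X' q (\<lambda>r. Y' r f)) - (\<lambda>q. Y' q (\<lambda>r. X' r f))) =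
       Z' p (\<lambda>q. X' q (\<lambda>r. Y' r f)) - Z' p (\<lambda>q. Y' q (\<lambda>r. X' r f))"
      by (rule vector_field_apply_diff[OF A that(4)
            vector_field_apply_smooth[OF that(2) vector_field_apply_smooth[OF that(3,1)]]
            vector_field_apply_smooth[OF that(3) vector_field_apply_smooth[OF that(2,1)]]])
    then show ?thesis by (simp only: lie_bracket_def fun_diff_def)
  qed
  show "(lie_bracket (lie_bracket X Y) Z + lie_bracket (lie_bracket Y Z) X
    + lie_bracket (lie_bracket Z X) Y) p f = 0 p f"
  proof (cases "f \<in> smooth_functions A")
    case True
    then show ?thesis by (simp only: plus_fun_apply zero_fun_apply double X Y Z)
  next
    case False
    have zero: "(\<lambda>q. V q f) = (\<lambda>q. 0)" if "V \<in> vector_fields A" for V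
      by (rule ext, rule vector_field_nonsmooth[OF that False])
    have const: "V q (\<lambda>q. 0) = 0" if V: "V \<in> vector_fields A" for V q
    proof (cases "(\<lambda>_. 0) \<in> smooth_functions A")
      case True
      show ?thesis
        using vector_field_apply_add[OF V True True, of q] by (simp add: plus_fun_def)
    qed (rule vector_field_nonsmooth[OF V])
    show ?thesis
      by (simp add: lie_bracket_def zero[OF X] zero[OF Y] zero[OF Z] const[OF X] const[OF Y] const[OF Z])
  qed
qed

text \<open>Covariant differentiation, \<open>J\<close>, \<open>\<eta>\<close> and the metric are additive only on the subgroup of smooth
  vector fields, so the usual consequences of additivity are recorded relative to a subgroup.\<close>

lemma additive_on_diff:
  fixes F :: "'b::ab_group_add \<Rightarrow> 'c::ab_group_add"
  assumes "\<And>x y. x \<in> V \<Longrightarrow> y \<in> V \<Longrightarrow> F (x + y) = F x + F y"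
    and "\<And>x y. x \<in> V \<Longrightarrow> y \<in> V \<Longrightarrow> x - y \<in> V"
    and "x \<in> V" "y \<in> V"
  shows "F (x - y) = F x - F y"
  using assms(1)[of "x - y" y] assms(2-4) by (simp add: algebra_simps)

lemma additive_on_uminus:
  fixes F :: "'b::ab_group_add \<Rightarrow> 'c::ab_group_add"
  assumes "\<And>x y. x \<in> V \<Longrightarrow> y \<in> V \<Longrightarrow> F (x + y) = F x + F y"
    and "\<And>x y. x \<in> V \<Longrightarrow> y \<in> V \<Longrightarrow> x - y \<in> V"
    and "x \<in> V"
  shows "F (- x) = - F x"
proof -
  have "0 \<in> V" using assms(2)[OF assms(3,3)] by simp
  then show ?thesis
    using additive_on_diff[OF assms(1,2) \<open>0 \<in> V\<close> assms(3)]
      additive_on_diff[OF assms(1,2) \<open>0 \<in> V\<close> \<open>0 \<in> V\<close>] by simp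
qed

text \<open>The groups of functions and of vector fields are torsion free. This replaces division by two:
  the factor in the definition of \<open>\<eta>\<close> never has to be moved through other operations.\<close>

lemma double_cancel_fun:
  fixes f h :: "'b \<Rightarrow> real"
  assumes "f + f = h + h" shows "f = h"
proof
  fix x show "f x = h x" using fun_cong[OF assms, of x] by simp
qed

lemma double_cancel_vfield:
  fixes V W :: "'a vfield"
  assumes "V + V = W + W" shows "V = W"
proof -
  have "V p = W p" for p
    by (rule double_cancel_fun) (use fun_cong[OF assms, of p] in \<open>simp only: plus_fun_apply\<close>)
  then show ?thesis by (rule ext)
qed

section \<open>Curvature of the Levi-Civita connection\<close>

locale almost_hermitian_manifold =
  fixes A :: "('a::{t2_space, second_countable_topology}, 'e::euclidean_space) chart set"
    and g :: "'a \<Rightarrow> 'a tvec \<Rightarrow> 'a tvec \<Rightarrow> real"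
    and J :: "'a \<Rightarrow> 'a tvec \<Rightarrow> 'a tvec"
    and D :: "'a connection"
  assumes almost_hermitian: "almost_hermitian A g J"
    and levi_civita: "levi_civita_connection A g D"
begin

abbreviation VF :: "'a vfield set" where "VF \<equiv> vector_fields A"
abbreviation JJ :: "'a vfield \<Rightarrow> 'a vfield" where "JJ \<equiv> endo_app J"
abbreviation m :: "'a vfield \<Rightarrow> 'a vfield \<Rightarrow> 'a \<Rightarrow> real" where "m \<equiv> metric_app g"
abbreviation K :: "'a vfield \<Rightarrow> 'a vfield \<Rightarrow> 'a vfield \<Rightarrow> 'a vfield" where "K \<equiv> curvature D"
abbreviation R :: "'a vfield \<Rightarrow> 'a vfield \<Rightarrow> 'a vfield \<Rightarrow> 'a vfield \<Rightarrow> 'a \<Rightarrow> real"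
  where "R \<equiv> curvature4 g D"

lemma smooth_atlas: "smooth_atlas A"
  using almost_hermitian by (simp add: almost_hermitian_def)

lemmas VF_add [simp] = vector_fields_add[OF smooth_atlas]
lemmas VF_diff [simp] = vector_fields_diff[OF smooth_atlas]
lemmas VF_uminus [simp] = vector_fields_uminus[OF smooth_atlas]

lemma VF_at: "X \<in> VF \<Longrightarrow> X p \<in> tangent_space A p"
  by (simp add: vector_fields_def)

lemma J_VF [simp]: "X \<in> VF \<Longrightarrow> JJ X \<in> VF"
  using almost_hermitian by (simp add: almost_hermitian_def almost_complex_structure_def)

lemma J_J [simp]: "X \<in> VF \<Longrightarrow> JJ (JJ X) = - X"
  using almost_hermitian VF_at
  by (auto simp: almost_hermitian_def almost_complex_structure_def endo_app_def fun_eq_iff)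

lemma J_add [simp]: "X \<in> VF \<Longrightarrow> Y \<in> VF \<Longrightarrow> JJ (X + Y) = JJ X + JJ Y"
proof -
  assume "X \<in> VF" "Y \<in> VF"
  then have "JJ (X + Y) p = (JJ X + JJ Y) p" for p
    using almost_hermitian VF_at[of X p] VF_at[of Y p]
    by (simp add: almost_hermitian_def almost_complex_structure_def endo_app_def)
  then show ?thesis by (rule ext)
qed

lemmas J_diff [simp] = additive_on_diff[of VF JJ, OF J_add VF_diff]
lemmas J_uminus [simp] = additive_on_uminus[of VF JJ, OF J_add VF_diff]

lemma D_VF [simp]: "X \<in> VF \<Longrightarrow> Y \<in> VF \<Longrightarrow> D X Y \<in> VF"
  using levi_civita by (simp add: levi_civita_connection_def affine_connection_def)

lemma D_add_left [simp]: "X \<in> VF \<Longrightarrow> Y \<in> VF \<Longrightarrow> Z \<in> VF \<Longrightarrow> D (X + Y) Z = D X Z + D Y Z"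
  using levi_civita by (simp add: levi_civita_connection_def affine_connection_def)

lemma D_add_right [simp]: "X \<in> VF \<Longrightarrow> Y \<in> VF \<Longrightarrow> Z \<in> VF \<Longrightarrow> D X (Y + Z) = D X Y + D X Z"
  using levi_civita by (simp add: levi_civita_connection_def affine_connection_def)

lemma D_diff_left [simp]: "X \<in> VF \<Longrightarrow> Y \<in> VF \<Longrightarrow> Z \<in> VF \<Longrightarrow> D (X - Y) Z = D X Z - D Y Z"
  by (rule additive_on_diff[of VF "\<lambda>X. D X Z"]) auto

lemma D_diff_right [simp]: "X \<in> VF \<Longrightarrow> Y \<in> VF \<Longrightarrow> Z \<in> VF \<Longrightarrow> D X (Y - Z) = D X Y - D X Z"
  by (rule additive_on_diff[of VF "D X"]) auto

lemma D_uminus_left [simp]: "X \<in> VF \<Longrightarrow> Y \<in> VF \<Longrightarrow> D (- X) Y = - D X Y"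
  by (rule additive_on_uminus[of VF "\<lambda>X. D X Y"]) auto

lemma D_uminus_right [simp]: "X \<in> VF \<Longrightarrow> Y \<in> VF \<Longrightarrow> D X (- Y) = - D X Y"
  by (rule additive_on_uminus[of VF "D X"]) auto

lemma lie_bracket_eq: "X \<in> VF \<Longrightarrow> Y \<in> VF \<Longrightarrow> lie_bracket X Y = D X Y - D Y X"
  using levi_civita by (simp add: levi_civita_connection_def)

lemma lie_bracket_VF: "X \<in> VF \<Longrightarrow> Y \<in> VF \<Longrightarrow> lie_bracket X Y \<in> VF"
  by (simp add: lie_bracket_eq)

lemma m_smooth: "X \<in> VF \<Longrightarrow> Y \<in> VF \<Longrightarrow> m X Y \<in> smooth_functions A"
  using almost_hermitian by (simp add: almost_hermitian_def riemannian_metric_def)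

lemma m_sym: "X \<in> VF \<Longrightarrow> Y \<in> VF \<Longrightarrow> m X Y = m Y X"
  using almost_hermitian VF_at
  by (auto simp: almost_hermitian_def riemannian_metric_def metric_app_def fun_eq_iff)

lemma m_add_left [simp]: "X \<in> VF \<Longrightarrow> Y \<in> VF \<Longrightarrow> Z \<in> VF \<Longrightarrow> m (X + Y) Z = m X Z + m Y Z"
  using almost_hermitian VF_at
  by (auto simp: almost_hermitian_def riemannian_metric_def metric_app_def fun_eq_iff)

lemma m_diff_left [simp]: "X \<in> VF \<Longrightarrow> Y \<in> VF \<Longrightarrow> Z \<in> VF \<Longrightarrow> m (X - Y) Z = m X Z - m Y Z"
  by (rule additive_on_diff[of VF "\<lambda>X. m X Z"]) auto

lemma m_uminus_left [simp]: "X \<in> VF \<Longrightarrow> Z \<in> VF \<Longrightarrow> m (- X) Z = - m X Z"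
  by (rule additive_on_uminus[of VF "\<lambda>X. m X Z"]) auto

lemma m_uminus_right [simp]: "X \<in> VF \<Longrightarrow> Z \<in> VF \<Longrightarrow> m X (- Z) = - m X Z"
  by (metis VF_uminus m_sym m_uminus_left)

lemma m_J_J: "X \<in> VF \<Longrightarrow> Y \<in> VF \<Longrightarrow> m (JJ X) (JJ Y) = m X Y"
  using almost_hermitian VF_at by (auto simp: almost_hermitian_def metric_app_def endo_app_def)

lemma m_J_right: "X \<in> VF \<Longrightarrow> Y \<in> VF \<Longrightarrow> m X (JJ Y) = - m (JJ X) Y"
  using m_J_J[of X "JJ Y"] by (metis J_J J_VF m_uminus_right minus_minus)

text \<open>Nondegeneracy is tested on \<open>V - W\<close> itself, which is again a smooth vector field; its length
  vanishes at every point.\<close>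

lemma eq_if_m_eq:
  assumes "V \<in> VF" "W \<in> VF" "\<And>U. U \<in> VF \<Longrightarrow> m V U = m W U"
  shows "V = W"
proof -
  have "(V - W) p = 0" for p
  proof (rule ccontr)
    assume nz: "(V - W) p \<noteq> 0"
    have "(V - W) p \<in> tangent_space A p" using assms(1,2) VF_at[of "V - W" p] by simp
    then have "g p ((V - W) p) ((V - W) p) > 0"
      using nz almost_hermitian by (simp add: almost_hermitian_def riemannian_metric_def)
    moreover have "m (V - W) (V - W) = 0" using assms by simp
    then have "g p ((V - W) p) ((V - W) p) = 0" by (metis metric_app_def zero_fun_apply)
    ultimately show False by simp
  qed
  then have "V - W = 0" by (simp add: fun_eq_iff)
  then show ?thesis by simp
qed

lemma metric_compatible:
  "X \<in> VF \<Longrightarrow> Y \<in> VF \<Longrightarrow> Z \<in> VF \<Longrightarrow> X p (m Y Z) = m (D X Y) Z p + m Y (D X Z) p"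
  using levi_civita by (auto simp: levi_civita_connection_def fun_eq_iff)

lemma K_VF [simp]: "X \<in> VF \<Longrightarrow> Y \<in> VF \<Longrightarrow> Z \<in> VF \<Longrightarrow> K X Y Z \<in> VF"
  by (simp add: curvature_def lie_bracket_eq)

text \<open>As \<open>D\<close> is torsion free, the cyclic sum of the curvature regroups into double Lie brackets, and
  the Bianchi identity becomes the Jacobi identity.\<close>

lemma K_bianchi:
  assumes "X \<in> VF" "Y \<in> VF" "Z \<in> VF"
  shows "K X Y Z + K Y Z X + K Z X Y = 0"
proof -
  have "K X Y Z + K Y Z X + K Z X Y =
     lie_bracket (lie_bracket X Y) Z + lie_bracket (lie_bracket Y Z) X
    + lie_bracket (lie_bracket Z X) Y"
    using assms by (simp add: curvature_def lie_bracket_eq algebra_simps)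
  also have "\<dots> = 0"
    by (rule lie_bracket_jacobi[OF smooth_atlas assms])
  finally show ?thesis .
qed

lemma K_skew:
  assumes "X \<in> VF" "Y \<in> VF" "Z \<in> VF"
  shows "K Y X Z = - K X Y Z"
  using assms by (simp add: curvature_def lie_bracket_eq algebra_simps)

text \<open>Let the commutator of \<open>X\<close> and \<open>Y\<close> act on the function \<open>g(Z,U)\<close>: by metric compatibility,
  applied twice, the mixed first-order terms are symmetric in \<open>X, Y\<close> and drop out, and comparison with
  the derivative along the Lie bracket leaves \<open>g(K(X,Y)Z, U) + g(Z, K(X,Y)U) = 0\<close>.\<close>

lemma R_skew_right:
  assumes X: "X \<in> VF" and Y: "Y \<in> VF" and Z: "Z \<in> VF" and U: "U \<in> VF"
  shows "R X Y Z U p = - R X Y U Z p"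
proof -
  have second: "X' p (\<lambda>q. Y' q (m Z U)) = m (D X' (D Y' Z)) U p + m (D Y' Z) (D X' U) p
     + m (D X' Z) (D Y' U) p + m Z (D X' (D Y' U)) p"
    if "X' \<in> VF" "Y' \<in> VF" for X' Y'
  proof -
    have "(\<lambda>q. Y' q (m Z U)) = m (D Y' Z) U + m Z (D Y' U)"
      using that Z U by (auto simp: metric_compatible)
    then have "X' p (\<lambda>q. Y' q (m Z U)) = X' p (m (D Y' Z) U) + X' p (m Z (D Y' U))"
      using that Z U vector_field_apply_add[of X' A "m (D Y' Z) U" "m Z (D Y' U)" p] m_smooth
      by simp
    then show ?thesis using that Z U by (simp add: metric_compatible)
  qed
  have "lie_bracket X Y p (m Z U) = m (D X (D Y Z)) U p + m Z (D X (D Y U)) p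
      - (m (D Y (D X Z)) U p + m Z (D Y (D X U)) p)"
    by (simp add: lie_bracket_def second X Y)
  moreover have "lie_bracket X Y p (m Z U) = m (D (lie_bracket X Y) Z) U p + m Z (D (lie_bracket X Y) U) p"
    using assms lie_bracket_VF by (intro metric_compatible)
  ultimately have "m (K X Y Z) U p + m Z (K X Y U) p = 0"
    using assms by (simp add: curvature_def lie_bracket_eq m_sym[of Z])
  then show ?thesis using assms by (simp add: curvature4_def m_sym[of Z])
qed

text \<open>The classical octahedron argument: the four Bianchi identities obtained by rotating
  \<open>X, Y, Z, U\<close>, combined with both skew symmetries, yield twice the claim.\<close>

lemma R_pair_sym:
  assumes X: "X \<in> VF" and Y: "Y \<in> VF" and Z: "Z \<in> VF" and U: "U \<in> VF"
  shows "R X Y Z U = R Z U X Y"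
proof
  fix p
  have b: "R a b c d p + R b c a d p + R c a b d p = 0"
    if "a \<in> VF" "b \<in> VF" "c \<in> VF" "d \<in> VF" for a b c d
  proof -
    have "m (K a b c + K b c a + K c a b) d = m (K a b c) d + m (K b c a) d + m (K c a b) d"
      using that by simp
    moreover have "m (0::'a vfield) d = 0"
      using m_diff_left[of d d d] that by simp
    ultimately have "m (K a b c) d + m (K b c a) d + m (K c a b) d = 0"
      using that by (simp add: K_bianchi)
    from fun_cong[OF this, of p] show ?thesis by (simp add: curvature4_def)
  qed
  have l: "R b a c d p = - R a b c d p" if "a \<in> VF" "b \<in> VF" "c \<in> VF" "d \<in> VF" for a b c d
    using that by (simp add: curvature4_def K_skew[of a b c])
  note r = R_skew_right[where p = p]
  show "R X Y Z U p = R Z U X Y p"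
    using b[OF X Y Z U] b[OF Y Z U X] b[OF Z U X Y] b[OF U X Y Z]
      r[OF X Y Z U] r[OF Y Z X U] r[OF Z X Y U] r[OF Z U X Y] r[OF U X Y Z] r[OF U Y X Z]
      r[OF X Z U Y] r[OF Y U Z X] r[OF X U Y Z] r[OF U X Z Y] r[OF Z Y U X] r[OF Y Z U X]
      l[OF X Z Y U] l[OF Y U X Z] l[OF X U Y Z] l[OF Y Z X U] l[OF X Y Z U] l[OF Z U X Y]
      l[OF X Z U Y] l[OF Y U Z X] l[OF X U Z Y] l[OF Y Z U X] l[OF X Y U Z] l[OF Z U Y X]
    by linarith
qed

end

section \<open>The canonical Hermitian connection\<close>

locale quasi_kaehler_manifold = almost_hermitian_manifold +
  assumes quasi_kaehler: "quasi_kaehler A J D"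
begin

text \<open>\<open>T\<close> is the torsion of the canonical Hermitian connection \<open>DD\<close>.\<close>

abbreviation \<eta> :: "'a vfield \<Rightarrow> 'a vfield \<Rightarrow> 'a vfield" where "\<eta> \<equiv> eta D J"
abbreviation DD :: "'a connection" where "DD \<equiv> canonical_hermitian_connection D J"
abbreviation E :: "'a vfield \<Rightarrow> 'a vfield \<Rightarrow> 'a vfield \<Rightarrow> 'a vfield" where
  "E \<equiv> cov_deriv_bilinear DD \<eta>"
abbreviation T :: "'a vfield \<Rightarrow> 'a vfield \<Rightarrow> 'a vfield" where
  "T X Y \<equiv> \<eta> X Y - \<eta> Y X"

text \<open>The part of the curvature operator \<open>K X Y\<close> that anticommutes with \<open>J\<close>, in terms of \<open>\<eta>\<close>; see
  \<open>K_anticommuting_part\<close>.\<close>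

definition N :: "'a vfield \<Rightarrow> 'a vfield \<Rightarrow> 'a vfield \<Rightarrow> 'a vfield" where
  "N X Y Z = E X Y Z - E Y X Z + \<eta> (T X Y) Z"

lemma eta_VF [simp]: "X \<in> VF \<Longrightarrow> Y \<in> VF \<Longrightarrow> \<eta> X Y \<in> VF"
  by (simp add: eta_def cov_deriv_endo_def vector_fields_scale[OF smooth_atlas])

lemma eta_double: "X \<in> VF \<Longrightarrow> Y \<in> VF \<Longrightarrow> \<eta> X Y + \<eta> X Y = - D X Y - JJ (D X (JJ Y))"
proof -
  assume "X \<in> VF" "Y \<in> VF"
  then have "cov_deriv_endo D J X (JJ Y) = - D X Y - JJ (D X (JJ Y))"
    by (simp add: cov_deriv_endo_def)
  then show ?thesis by (auto simp: eta_def fscale_def tscale_def fun_eq_iff)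
qed

lemma eta_add_left [simp]: "X \<in> VF \<Longrightarrow> Y \<in> VF \<Longrightarrow> Z \<in> VF \<Longrightarrow> \<eta> (X + Y) Z = \<eta> X Z + \<eta> Y Z"
proof (rule double_cancel_vfield)
  assume a: "X \<in> VF" "Y \<in> VF" "Z \<in> VF"
  have "\<eta> X Z + \<eta> Y Z + (\<eta> X Z + \<eta> Y Z) = (\<eta> X Z + \<eta> X Z) + (\<eta> Y Z + \<eta> Y Z)"
    by (simp only: add_ac)
  then show "\<eta> (X + Y) Z + \<eta> (X + Y) Z = \<eta> X Z + \<eta> Y Z + (\<eta> X Z + \<eta> Y Z)"
    using a by (simp add: eta_double)
qed

lemma eta_add_right [simp]: "X \<in> VF \<Longrightarrow> Y \<in> VF \<Longrightarrow> Z \<in> VF \<Longrightarrow> \<eta> X (Y + Z) = \<eta> X Y + \<eta> X Z"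
proof (rule double_cancel_vfield)
  assume a: "X \<in> VF" "Y \<in> VF" "Z \<in> VF"
  have "\<eta> X Y + \<eta> X Z + (\<eta> X Y + \<eta> X Z) = (\<eta> X Y + \<eta> X Y) + (\<eta> X Z + \<eta> X Z)"
    by (simp only: add_ac)
  then show "\<eta> X (Y + Z) + \<eta> X (Y + Z) = \<eta> X Y + \<eta> X Z + (\<eta> X Y + \<eta> X Z)"
    using a by (simp add: eta_double)
qed

lemma eta_diff_left [simp]: "X \<in> VF \<Longrightarrow> Y \<in> VF \<Longrightarrow> Z \<in> VF \<Longrightarrow> \<eta> (X - Y) Z = \<eta> X Z - \<eta> Y Z"
  by (rule additive_on_diff[of VF "\<lambda>X. \<eta> X Z"]) auto

lemma eta_uminus_left [simp]: "X \<in> VF \<Longrightarrow> Z \<in> VF \<Longrightarrow> \<eta> (- X) Z = - \<eta> X Z"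
  by (rule additive_on_uminus[of VF "\<lambda>X. \<eta> X Z"]) auto

lemma eta_diff_right [simp]: "X \<in> VF \<Longrightarrow> Y \<in> VF \<Longrightarrow> Z \<in> VF \<Longrightarrow> \<eta> X (Y - Z) = \<eta> X Y - \<eta> X Z"
  by (rule additive_on_diff[of VF "\<eta> X"]) auto

lemma eta_uminus_right [simp]: "X \<in> VF \<Longrightarrow> Z \<in> VF \<Longrightarrow> \<eta> X (- Z) = - \<eta> X Z"
  by (rule additive_on_uminus[of VF "\<eta> X"]) auto

text \<open>The derivative of \<open>J\<close> is recovered from \<open>\<eta>\<close> as \<open>D\<^sub>X J = 2 J \<eta>\<^sub>X\<close>.\<close>

lemma J_eta_double:
  assumes "X \<in> VF" "Y \<in> VF"
  shows "JJ (\<eta> X Y) + JJ (\<eta> X Y) = D X (JJ Y) - JJ (D X Y)"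
proof -
  have "JJ (\<eta> X Y) + JJ (\<eta> X Y) = JJ (\<eta> X Y + \<eta> X Y)"
    using J_add[OF eta_VF eta_VF, OF assms assms] by (rule sym)
  also have "\<dots> = D X (JJ Y) - JJ (D X Y)"
    unfolding eta_double[OF assms] using assms by simp
  finally show ?thesis .
qed

lemma eta_J_right [simp]: "X \<in> VF \<Longrightarrow> Y \<in> VF \<Longrightarrow> \<eta> X (JJ Y) = - JJ (\<eta> X Y)"
proof (rule double_cancel_vfield)
  assume a: "X \<in> VF" "Y \<in> VF"
  have "- JJ (\<eta> X Y) + - JJ (\<eta> X Y) = - (JJ (\<eta> X Y) + JJ (\<eta> X Y))" by simp
  then show "\<eta> X (JJ Y) + \<eta> X (JJ Y) = - JJ (\<eta> X Y) + - JJ (\<eta> X Y)"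
    using a by (simp add: eta_double J_eta_double)
qed

text \<open>This is the quasi-Kaehler condition expressed by \<open>\<eta>\<close>.\<close>

lemma eta_J_left [simp]: "X \<in> VF \<Longrightarrow> Y \<in> VF \<Longrightarrow> \<eta> (JJ X) Y = - JJ (\<eta> X Y)"
proof (rule double_cancel_vfield)
  assume a: "X \<in> VF" "Y \<in> VF"
  have "- JJ (\<eta> X Y) + - JJ (\<eta> X Y) = - (JJ (\<eta> X Y) + JJ (\<eta> X Y))" by simp
  moreover have "cov_deriv_endo D J (JJ X) (JJ Y) = - JJ (cov_deriv_endo D J X (JJ Y))"
    using quasi_kaehler a by (simp add: quasi_kaehler_def)
  then have "- D (JJ X) Y - JJ (D (JJ X) (JJ Y)) = JJ (D X Y) - D X (JJ Y)"
    using a by (simp add: cov_deriv_endo_def)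
  ultimately show "\<eta> (JJ X) Y + \<eta> (JJ X) Y = - JJ (\<eta> X Y) + - JJ (\<eta> X Y)"
    using a by (simp add: eta_double J_eta_double)
qed

lemma DD_VF [simp]: "X \<in> VF \<Longrightarrow> Y \<in> VF \<Longrightarrow> DD X Y \<in> VF"
  by (simp add: canonical_hermitian_connection_def)

lemma DD_uminus_right: "X \<in> VF \<Longrightarrow> Y \<in> VF \<Longrightarrow> DD X (- Y) = - DD X Y"
  by (simp add: canonical_hermitian_connection_def)

text \<open>The defining feature of the canonical Hermitian connection: the commutator
  \<open>[\<eta>\<^sub>X, J] = -2 J \<eta>\<^sub>X\<close> cancels \<open>D\<^sub>X J\<close>.\<close>

lemma DD_J: "X \<in> VF \<Longrightarrow> Y \<in> VF \<Longrightarrow> DD X (JJ Y) = JJ (DD X Y)"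
proof -
  assume a: "X \<in> VF" "Y \<in> VF"
  have "D X (JJ Y) = JJ (\<eta> X Y) + JJ (\<eta> X Y) + JJ (D X Y)"
    using J_eta_double[OF a] by (simp add: algebra_simps)
  then show ?thesis using a by (simp add: canonical_hermitian_connection_def)
qed

lemma curvature_DD_J:
  assumes "X \<in> VF" "Y \<in> VF" "Z \<in> VF"
  shows "curvature DD X Y (JJ Z) = JJ (curvature DD X Y Z)"
  using assms by (simp add: curvature_def lie_bracket_eq DD_J)

lemma E_VF [simp]: "X \<in> VF \<Longrightarrow> Y \<in> VF \<Longrightarrow> Z \<in> VF \<Longrightarrow> E X Y Z \<in> VF"
  by (simp add: cov_deriv_bilinear_def)

text \<open>The symmetries of \<open>\<eta>\<close> under \<open>J\<close> survive differentiation because \<open>J\<close> is parallel for \<open>DD\<close>.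
  There is no such rule for the first argument of \<open>E\<close>; the theorem is about that argument.\<close>

lemma E_J_middle [simp]:
  assumes "X \<in> VF" "Y \<in> VF" "Z \<in> VF"
  shows "E X (JJ Y) Z = - JJ (E X Y Z)"
  using assms by (simp add: cov_deriv_bilinear_def DD_J DD_uminus_right)

lemma E_J_right [simp]:
  assumes "X \<in> VF" "Y \<in> VF" "Z \<in> VF"
  shows "E X Y (JJ Z) = - JJ (E X Y Z)"
  using assms by (simp add: cov_deriv_bilinear_def DD_J DD_uminus_right)

section \<open>The part of the curvature anticommuting with \<open>J\<close>\<close>

text \<open>Both connections use the same Lie bracket in their curvature. Rewriting \<open>D'\<^sub>X Y - D'\<^sub>Y X - [X,Y]\<close>
  as the torsion of \<open>D' = DD\<close> is what produces the term \<open>\<eta>\<^sub>T\<close> in \<open>N\<close>.\<close>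

lemma K_decomposition:
  assumes "X \<in> VF" "Y \<in> VF" "Z \<in> VF"
  shows "K X Y Z = curvature DD X Y Z + N X Y Z - (\<eta> X (\<eta> Y Z) - \<eta> Y (\<eta> X Z))"
  using assms
  by (simp add: N_def cov_deriv_bilinear_def curvature_def canonical_hermitian_connection_def
      lie_bracket_eq algebra_simps)

lemma N_VF [simp]: "X \<in> VF \<Longrightarrow> Y \<in> VF \<Longrightarrow> Z \<in> VF \<Longrightarrow> N X Y Z \<in> VF"
  by (simp add: N_def del: eta_diff_left)

lemma N_skew:
  assumes "X \<in> VF" "Y \<in> VF" "Z \<in> VF"
  shows "N Y X Z = - N X Y Z"
  using assms by (simp add: N_def)

lemma N_J_right:
  assumes "X \<in> VF" "Y \<in> VF" "Z \<in> VF"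
  shows "N X Y (JJ Z) = - JJ (N X Y Z)"
  using assms by (simp add: N_def)

lemma N_uminus_right:
  assumes "X \<in> VF" "Y \<in> VF" "Z \<in> VF"
  shows "N X Y (- Z) = - N X Y Z"
  using N_J_right[of X Y "JJ Z"] assms by (simp add: N_J_right)

lemma N_uminus_middle:
  assumes "X \<in> VF" "Y \<in> VF" "Z \<in> VF"
  shows "N X (- Y) Z = - N X Y Z"
  using assms by (simp add: N_def cov_deriv_bilinear_def canonical_hermitian_connection_def algebra_simps)

text \<open>Conjugation \<open>L \<mapsto> J L J\<close> is \<open>-1\<close> on operators commuting with \<open>J\<close> and \<open>1\<close> on those anticommuting
  with it, so adding it projects \<open>K_decomposition\<close> to twice the term \<open>N\<close>.\<close>

lemma K_anticommuting_part:
  assumes "X \<in> VF" "Y \<in> VF" "Z \<in> VF"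
  shows "K X Y Z + JJ (K X Y (JJ Z)) = N X Y Z + N X Y Z"
proof -
  have C: "curvature DD X Y Z \<in> VF"
    using assms by (simp add: curvature_def lie_bracket_eq)
  show ?thesis
    using assms C by (simp add: K_decomposition curvature_DD_J N_J_right)
qed

lemma R_minus_R_J_J:
  assumes "X \<in> VF" "Y \<in> VF" "Z \<in> VF" "U \<in> VF"
  shows "R X Y Z U - R X Y (JJ Z) (JJ U) = m (N X Y Z) U + m (N X Y Z) U"
proof -
  have "R X Y Z U - R X Y (JJ Z) (JJ U) = m (K X Y Z + JJ (K X Y (JJ Z))) U"
    using assms by (simp add: curvature4_def m_J_right)
  also have "\<dots> = m (N X Y Z) U + m (N X Y Z) U"
    unfolding K_anticommuting_part[OF assms(1-3)] using assms by (intro m_add_left N_VF)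
  finally show ?thesis .
qed

section \<open>The second Gray condition\<close>

text \<open>On the left of the Gray condition \<open>J\<close> acts on the first pair; pair symmetry moves it to the second
  one. On the right \<open>U = -J J U\<close> turns the sum into a difference of the same shape. Both sides are
  then twice an entry of \<open>N\<close>.\<close>

lemma second_gray_iff_N:
  "second_gray_condition A g J D \<longleftrightarrow>
    (\<forall>X\<in>VF. \<forall>Y\<in>VF. \<forall>Z\<in>VF. \<forall>U\<in>VF. m (N Z U X) Y = m (N (JJ X) Y Z) (JJ U))"
proof -
  have "(R X Y Z U - R (JJ X) (JJ Y) Z U = R (JJ X) Y (JJ Z) U + R (JJ X) Y Z (JJ U)) \<longleftrightarrow>
     m (N Z U X) Y = m (N (JJ X) Y Z) (JJ U)"
    if "X \<in> VF" "Y \<in> VF" "Z \<in> VF" "U \<in> VF" for X Y Z U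
  proof -
    have "R X Y Z U - R (JJ X) (JJ Y) Z U = R Z U X Y - R Z U (JJ X) (JJ Y)"
      using that by (simp add: R_pair_sym[of _ _ Z U])
    then have l: "R X Y Z U - R (JJ X) (JJ Y) Z U = m (N Z U X) Y + m (N Z U X) Y"
      using that by (simp add: R_minus_R_J_J)
    have "R (JJ X) Y (JJ Z) U + R (JJ X) Y Z (JJ U)
       = R (JJ X) Y Z (JJ U) - R (JJ X) Y (JJ Z) (JJ (JJ U))"
      using that by (simp add: curvature4_def)
    then have r: "R (JJ X) Y (JJ Z) U + R (JJ X) Y Z (JJ U)
       = m (N (JJ X) Y Z) (JJ U) + m (N (JJ X) Y Z) (JJ U)"
      using that R_minus_R_J_J[of "JJ X" Y Z "JJ U"] by simp
    show ?thesis unfolding l r using double_cancel_fun by metis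
  qed
  then show ?thesis by (simp add: second_gray_condition_def)
qed

text \<open>Antisymmetrising the curvature tensor under \<open>J\<close> in both pairs of arguments preserves pair
  symmetry. In the second pair this produces \<open>N\<close> by \<open>R_minus_R_J_J\<close>, and on \<open>N\<close> the first pair is
  antisymmetric already by assumption.\<close>

lemma N_pair_sym:
  assumes anti: "\<And>X Y Z. X \<in> VF \<Longrightarrow> Y \<in> VF \<Longrightarrow> Z \<in> VF \<Longrightarrow> N (JJ X) (JJ Y) Z = - N X Y Z"
    and X: "X \<in> VF" and Y: "Y \<in> VF" and Z: "Z \<in> VF" and U: "U \<in> VF"
  shows "m (N X Y Z) U = m (N Z U X) Y"
proof -
  have S: "(R a b c d - R a b (JJ c) (JJ d)) - (R (JJ a) (JJ b) c d - R (JJ a) (JJ b) (JJ c) (JJ d))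
     = m (N a b c) d + m (N a b c) d + (m (N a b c) d + m (N a b c) d)"
    if "a \<in> VF" "b \<in> VF" "c \<in> VF" "d \<in> VF" for a b c d
    using that by (simp add: R_minus_R_J_J anti)
  have "m (N X Y Z) U + m (N X Y Z) U + (m (N X Y Z) U + m (N X Y Z) U)
     = m (N Z U X) Y + m (N Z U X) Y + (m (N Z U X) Y + m (N Z U X) Y)"
    unfolding S[OF X Y Z U, symmetric] S[OF Z U X Y, symmetric]
    using X Y Z U
    by (simp add: R_pair_sym[of Z U] R_pair_sym[of "JJ Z" "JJ U"] algebra_simps)
  then show ?thesis by (blast dest: double_cancel_fun)
qed

text \<open>The subtle point is that pair symmetry of \<open>N\<close> is not known before \<open>J\<close>-anti-invariance in the first
  pair is. In the Gray condition \<open>g(N(Z,U)X, Y) = g(N(JX,Y)Z, JU)\<close> one side carries the pair \<open>X, Y\<close>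
  as arguments of \<open>N\<close> and the other one as the last pair, where replacing \<open>X, Y\<close> by \<open>JX, JY\<close>
  changes the sign. This gives \<open>N(JX,Y) = N(X,JY)\<close>, and hence the anti-invariance. With pair symmetry both
  sides are values of \<open>N(\<cdot>,Y)Z\<close>, and nondegeneracy strips off \<open>U\<close>. Conversely, the identity for \<open>N\<close>
  gives anti-invariance directly by skewness of \<open>N\<close>.\<close>

lemma second_gray_iff_N_J:
  "second_gray_condition A g J D \<longleftrightarrow>
    (\<forall>X\<in>VF. \<forall>Y\<in>VF. \<forall>Z\<in>VF. N (JJ X) Y Z = JJ (N X Y Z))"
proof
  assume "second_gray_condition A g J D"
  then have G: "m (N Z U X) Y = - m (JJ (N (JJ X) Y Z)) U"
    if "X \<in> VF" "Y \<in> VF" "Z \<in> VF" "U \<in> VF" for X Y Z U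
    using that by (simp add: second_gray_iff_N m_J_right)
  \<comment> \<open>the Gray condition for \<open>X, Y\<close> and for \<open>-JX, JY\<close>, with the same left-hand side\<close>
  have swap: "N (JJ X) Y Z = N X (JJ Y) Z" if XYZ: "X \<in> VF" "Y \<in> VF" "Z \<in> VF" for X Y Z
  proof (rule eq_if_m_eq)
    fix U assume U: "U \<in> VF"
    have "m (N (JJ X) Y Z) U = m (N Z (- JJ U) X) Y"
      using G[of "X" Y Z "- JJ U"] XYZ U by (simp add: m_J_right)
    also have "\<dots> = m (N Z (- JJ U) (- JJ X)) (JJ Y)"
      using XYZ U by (simp add: N_J_right N_uminus_right m_J_J)
    also have "\<dots> = m (N X (JJ Y) Z) U"
      using G[of "- JJ X" "JJ Y" Z "- JJ U"] XYZ U by (simp add: m_J_right)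
    finally show "m (N (JJ X) Y Z) U = m (N X (JJ Y) Z) U" .
  qed (use XYZ in simp_all)
  have anti: "N (JJ X) (JJ Y) Z = - N X Y Z" if "X \<in> VF" "Y \<in> VF" "Z \<in> VF" for X Y Z
    using that by (simp add: swap N_uminus_middle)
  have "N (JJ X) Y Z = JJ (N X Y Z)" if XYZ: "X \<in> VF" "Y \<in> VF" "Z \<in> VF" for X Y Z
  proof -
    have "N X Y Z = - JJ (N (JJ X) Y Z)"
    proof (rule eq_if_m_eq)
      fix U assume U: "U \<in> VF"
      have "m (N X Y Z) U = m (N Z U X) Y"
        using XYZ U by (intro N_pair_sym anti)
      also have "\<dots> = m (- JJ (N (JJ X) Y Z)) U"
        using XYZ U G by simp
      finally show "m (N X Y Z) U = m (- JJ (N (JJ X) Y Z)) U" .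
    qed (use XYZ in simp_all)
    then have "JJ (N X Y Z) = JJ (- JJ (N (JJ X) Y Z))" by simp
    then show ?thesis using XYZ by simp
  qed
  then show "\<forall>X\<in>VF. \<forall>Y\<in>VF. \<forall>Z\<in>VF. N (JJ X) Y Z = JJ (N X Y Z)" by blast
next
  assume "\<forall>X\<in>VF. \<forall>Y\<in>VF. \<forall>Z\<in>VF. N (JJ X) Y Z = JJ (N X Y Z)"
  then have H: "N (JJ X) Y Z = JJ (N X Y Z)" if "X \<in> VF" "Y \<in> VF" "Z \<in> VF" for X Y Z
    using that by blast
  have "N (JJ X) (JJ Y) Z = - N X Y Z" if "X \<in> VF" "Y \<in> VF" "Z \<in> VF" for X Y Z
    using that by (simp add: H N_skew[of "JJ Y" X] N_skew[of X Y])
  then have "m (N Z U X) Y = m (N X Y Z) U" if "X \<in> VF" "Y \<in> VF" "Z \<in> VF" "U \<in> VF" for X Y Z U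
    using that N_pair_sym by metis
  then show "second_gray_condition A g J D"
    by (simp add: second_gray_iff_N H m_J_J)
qed

text \<open>The torsion terms cancel: \<open>T(JX,Y) = -J T(X,Y)\<close>, whence \<open>\<eta>\<close> along \<open>T(JX,Y)\<close> is \<open>J\<close> times \<open>\<eta>\<close>
  along \<open>T(X,Y)\<close>.\<close>

lemma N_J_iff_E_J:
  assumes "X \<in> VF" "Y \<in> VF" "Z \<in> VF"
  shows "N (JJ X) Y Z = JJ (N X Y Z) \<longleftrightarrow>
    E (JJ X) Y Z + JJ (E Y X Z) = JJ (E X Y Z) - JJ (E Y X Z)"
  using assms by (simp add: N_def algebra_simps)

text \<open>The identity for \<open>N\<close> lets one pull \<open>J\<close> out of the first argument of \<open>E\<close> at the price of a
  multiple of \<open>E(Y,X)\<close>. Evaluating \<open>E(JX,JY)\<close> in two ways, removing \<open>J\<close> from the second argument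
  first or from the first argument first, gives \<open>4 E(X,Y) = 4 E(Y,X)\<close>.\<close>

lemma E_symmetric_iff:
  "(\<forall>X\<in>VF. \<forall>Y\<in>VF. \<forall>Z\<in>VF. N (JJ X) Y Z = JJ (N X Y Z)) \<longleftrightarrow>
    (\<forall>X\<in>VF. \<forall>Y\<in>VF. \<forall>Z\<in>VF. E X Y Z = E Y X Z)"
proof
  assume "\<forall>X\<in>VF. \<forall>Y\<in>VF. \<forall>Z\<in>VF. N (JJ X) Y Z = JJ (N X Y Z)"
  then have EJ: "E (JJ X) Y Z = JJ (E X Y Z) - JJ (E Y X Z) - JJ (E Y X Z)"
    if "X \<in> VF" "Y \<in> VF" "Z \<in> VF" for X Y Z
    using that N_J_iff_E_J[of X Y Z] by (simp add: algebra_simps)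
  have "E X Y Z = E Y X Z" if XYZ: "X \<in> VF" "Y \<in> VF" "Z \<in> VF" for X Y Z
  proof -
    have JE: "JJ (E (JJ V) W Z) = E W V Z + E W V Z - E V W Z" if "V \<in> VF" "W \<in> VF" for V W
    proof -
      have "JJ (E (JJ V) W Z) = - E V W Z - - E W V Z - - E W V Z"
        by (simp only: EJ J_diff J_J J_VF E_VF VF_diff that XYZ)
      then show ?thesis by (simp add: algebra_simps)
    qed
    \<comment> \<open>the two evaluations of \<open>E(JX,JY)\<close>\<close>
    have "- JJ (E (JJ X) Y Z) = - JJ (JJ (E X Y Z)) - JJ (E (JJ Y) X Z) - JJ (E (JJ Y) X Z)"
      using EJ[of X "JJ Y" Z] XYZ by (simp only: E_J_middle J_uminus J_VF E_VF)
    then have "(E X Y Z + E X Y Z) + (E X Y Z + E X Y Z) = (E Y X Z + E Y X Z) + (E Y X Z + E Y X Z)"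
      by (simp add: JE XYZ algebra_simps)
    then show ?thesis by (blast dest: double_cancel_vfield)
  qed
  then show "\<forall>X\<in>VF. \<forall>Y\<in>VF. \<forall>Z\<in>VF. E X Y Z = E Y X Z" by blast
next
  assume H: "\<forall>X\<in>VF. \<forall>Y\<in>VF. \<forall>Z\<in>VF. E X Y Z = E Y X Z"
  have "N (JJ X) Y Z = JJ (N X Y Z)" if XYZ: "X \<in> VF" "Y \<in> VF" "Z \<in> VF" for X Y Z
  proof -
    have "E (JJ X) Y Z = E Y (JJ X) Z" "E Y X Z = E X Y Z"
      using H XYZ by simp_all
    then show ?thesis using XYZ by (simp add: N_J_iff_E_J)
  qed
  then show "\<forall>X\<in>VF. \<forall>Y\<in>VF. \<forall>Z\<in>VF. N (JJ X) Y Z = JJ (N X Y Z)" by blast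
qed

lemma E_J_J:
  assumes "\<forall>X\<in>VF. \<forall>Y\<in>VF. \<forall>Z\<in>VF. E X Y Z = E Y X Z" and XYZ: "X \<in> VF" "Y \<in> VF" "Z \<in> VF"
  shows "E (JJ X) (JJ Y) Z + E X Y Z = 0"
proof -
  have "E (JJ X) Y Z = E Y (JJ X) Z" "E Y X Z = E X Y Z" using assms by simp_all
  then show ?thesis using XYZ by simp
qed

end

theorem proposition3p1:
  fixes A :: "('a::{t2_space, second_countable_topology}, 'e::euclidean_space) chart set"
    and g :: "'a \<Rightarrow> 'a tvec \<Rightarrow> 'a tvec \<Rightarrow> real"
    and J :: "'a \<Rightarrow> 'a tvec \<Rightarrow> 'a tvec"
    and nabla :: "'a connection"
    and n :: nat
  assumes "DIM('e) = 2 * n"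
    and "almost_hermitian A g J"
    and "levi_civita_connection A g nabla"
    and "quasi_kaehler A J nabla"
  shows "(second_gray_condition A g J nabla \<longleftrightarrow>
           (\<forall>X\<in>vector_fields A. \<forall>Y\<in>vector_fields A. \<forall>Z\<in>vector_fields A.
              cov_deriv_bilinear (canonical_hermitian_connection nabla J) (eta nabla J) X Y Z =
              cov_deriv_bilinear (canonical_hermitian_connection nabla J) (eta nabla J) Y X Z)) \<and>
         (second_gray_condition A g J nabla \<longrightarrow>
           (\<forall>X\<in>vector_fields A. \<forall>Y\<in>vector_fields A. \<forall>Z\<in>vector_fields A.
              cov_deriv_bilinear (canonical_hermitian_connection nabla J) (eta nabla J)
                (endo_app J X) (endo_app J Y) Z +
              cov_deriv_bilinear (canonical_hermitian_connection nabla J) (eta nabla J) X Y Z = 0))"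
proof -
  interpret quasi_kaehler_manifold A g J nabla
    using assms by unfold_locales
  show ?thesis using second_gray_iff_N_J E_symmetric_iff E_J_J by blast
qed

end
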